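(* There does not exist a function $f\colon\mathbb{N}\to\mathbb{N}$ such that for every laminar matroid $M$ on a ground set $E=\{e_1,\ldots,e_n\}$, every total order $\preceq$ on $E$ with $e_1\prec\cdots\prec e_n$, and every $i\in\{0,\ldots,n-1\}$, the $i$-th width of the ZDD $\mathsf{Z}(\mathcal{I}(M))$ with respect to $(E,\preceq)$ is at most $f(\lambda_M(\{e_1,\ldots,e_i\}))$.
   Context: A family $\mathcal{A}\subseteq 2^E$ is laminar if $A\subseteq B$ or $B\subseteq A$ whenever $A,B\in\mathcal{A}$ and $A\cap B\neq\emptyset$. $M$ is laminar if there are a laminar family $\mathcal{A}$ and $c\colon\mathcal{A}\to\mathbb{N}$ such that $I\subseteq E$ is independent iff $|I\cap A|\le c(A)$ for all $A\in\mathcal{A}$. $\mathcal{I}(M)$ is the collection of independent sets, $r_M$ the rank function, and $\lambda_M(X)=r_M(X)+r_M(E\setminus X)-r_M(E)$. The ZDD $\mathsf{Z}(\mathcal{S})$ of $\mathcal{S}\subseteq 2^E$ w.r.t. $(E,\preceq)$ is obtained from the complete binary decision tree of $\mathcal{S}$ (internal nodes at depth $j$ labeled $e_{j+1}$, each with a 0-arc to $\nu_0$ and 1-arc to $\nu_1$; the leaf reached by taking 1-arcs exactly at elements of $X$ is the terminal $\top$ iff $X\in\mathcal{S}$, else $\bot$) by exhaustively merging non-terminal nodes with the same label and same 0- and 1-successors, and removing every non-terminal $\nu$ with $\nu_1=\bot$ (redirecting arcs entering $\nu$ to $\nu_0$). The $i$-th width is the number of non-terminal nodes labeled $e_{i+1}$.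 *)

theory Defs
  imports Main
begin

subsection \<open>Laminar matroids\<close>

definition matroid :: "'a set \<Rightarrow> 'a set set \<Rightarrow> bool" where
  "matroid E \<I> \<longleftrightarrow>
     finite E \<and> \<I> \<subseteq> Pow E \<and> {} \<in> \<I> \<and>
     (\<forall>X Y. X \<subseteq> Y \<and> Y \<in> \<I> \<longrightarrow> X \<in> \<I>) \<and>
     (\<forall>X\<in>\<I>. \<forall>Y\<in>\<I>. card X < card Y \<longrightarrow> (\<exists>y\<in>Y - X. insert y X \<in> \<I>))"

definition laminar_family :: "'a set \<Rightarrow> 'a set set \<Rightarrow> bool" where
  "laminar_family E \<A> \<longleftrightarrow>
     \<A> \<subseteq> Pow E \<and> (\<forall>A\<in>\<A>. \<forall>B\<in>\<A>. A \<inter> B \<noteq> {} \<longrightarrow> A \<subseteq> B \<or> B \<subseteq> A)"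

definition laminar_matroid :: "'a set \<Rightarrow> 'a set set \<Rightarrow> bool" where
  "laminar_matroid E \<I> \<longleftrightarrow>
     matroid E \<I> \<and>
     (\<exists>\<A> (c :: 'a set \<Rightarrow> nat). laminar_family E \<A> \<and>
        (\<forall>I. I \<subseteq> E \<longrightarrow> (I \<in> \<I> \<longleftrightarrow> (\<forall>A\<in>\<A>. card (I \<inter> A) \<le> c A))))"

definition rank_of :: "'a set set \<Rightarrow> 'a set \<Rightarrow> nat" where
  "rank_of \<I> X = Max (card ` {Y. Y \<subseteq> X \<and> Y \<in> \<I>})"

text \<open>The subtraction on the natural numbers never truncates for a matroid, because the rank
  function is subadditive.\<close>

definition connectivity :: "'a set \<Rightarrow> 'a set set \<Rightarrow> 'a set \<Rightarrow> nat" where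
  "connectivity E \<I> X = rank_of \<I> X + rank_of \<I> (E - X) - rank_of \<I> E"

subsection \<open>Zero-suppressed binary decision diagrams\<close>

text \<open>The field \<open>nodes\<close> is the set of non-terminal nodes; \<open>label\<close>, \<open>lo\<close> (0-successor) and
  \<open>hi\<close> (1-successor) are only meaningful on it.\<close>

datatype 'v vertex = Bot | Top | Inner 'v

record ('v, 'a) diagram =
  root :: "'v vertex"
  nodes :: "'v set"
  label :: "'v \<Rightarrow> 'a"
  lo :: "'v \<Rightarrow> 'v vertex"
  hi :: "'v \<Rightarrow> 'v vertex"

text \<open>A node of the complete binary decision tree is identified with the path leading to it from
  the root, where \<open>True\<close> stands for a 1-arc. The list \<open>es\<close> is \<open>e\<^sub>1, \<dots>, e\<^sub>n\<close>, so that
  \<open>es ! j\<close> is \<open>e\<^sub>j\<^sub>+\<^sub>1\<close>. All leaves are shared in the two terminals.\<close>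

definition tree_vertex :: "'a list \<Rightarrow> 'a set set \<Rightarrow> bool list \<Rightarrow> bool list vertex" where
  "tree_vertex es \<S> p =
     (if length p < length es then Inner p
      else if {es ! j | j. j < length es \<and> p ! j} \<in> \<S> then Top else Bot)"

definition decision_tree :: "'a list \<Rightarrow> 'a set set \<Rightarrow> (bool list, 'a) diagram" where
  "decision_tree es \<S> =
     \<lparr>root = tree_vertex es \<S> [],
      nodes = {p. length p < length es},
      label = (\<lambda>p. es ! length p),
      lo = (\<lambda>p. tree_vertex es \<S> (p @ [False])),
      hi = (\<lambda>p. tree_vertex es \<S> (p @ [True]))\<rparr>"

text \<open>Delete \<open>v\<close> and redirect all arcs entering it (and the root pointer) to \<open>w\<close>.\<close>

definition redirect :: "('v, 'a) diagram \<Rightarrow> 'v \<Rightarrow> 'v vertex \<Rightarrow> ('v, 'a) diagram" where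
  "redirect D v w =
     (let \<sigma> = (\<lambda>x. if x = Inner v then w else x) in
      \<lparr>root = \<sigma> (root D),
       nodes = nodes D - {v},
       label = label D,
       lo = \<sigma> \<circ> lo D,
       hi = \<sigma> \<circ> hi D\<rparr>)"

inductive reduces :: "('v, 'a) diagram \<Rightarrow> ('v, 'a) diagram \<Rightarrow> bool" where
  merge: "\<lbrakk>u \<in> nodes D; v \<in> nodes D; u \<noteq> v; label D u = label D v; lo D u = lo D v; hi D u = hi D v\<rbrakk>
     \<Longrightarrow> reduces D (redirect D v (Inner u))"
| remove: "\<lbrakk>v \<in> nodes D; hi D v = Bot\<rbrakk> \<Longrightarrow> reduces D (redirect D v (lo D v))"

definition is_ZDD :: "'a list \<Rightarrow> 'a set set \<Rightarrow> (bool list, 'a) diagram \<Rightarrow> bool" where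
  "is_ZDD es \<S> D \<longleftrightarrow> reduces\<^sup>*\<^sup>* (decision_tree es \<S>) D \<and> (\<nexists>D'. reduces D D')"

text \<open>Exhaustive reduction terminates, and its result is unique up to renaming of nodes; the
  choice operator fixes one of the isomorphic results.\<close>

definition ZDD :: "'a list \<Rightarrow> 'a set set \<Rightarrow> (bool list, 'a) diagram" where
  "ZDD es \<S> = (SOME D. is_ZDD es \<S> D)"

definition width :: "'a list \<Rightarrow> ('v, 'a) diagram \<Rightarrow> nat \<Rightarrow> nat" where
  "width es D i = card {v \<in> nodes D. label D v = es ! i}"

lemma nodes_redirect [simp]: "nodes (redirect D v w) = nodes D - {v}"
  by (simp add: redirect_def Let_def)

lemma reduces_nodes:
  assumes "reduces D D'" "finite (nodes D)"
  shows "finite (nodes D')" "card (nodes D') < card (nodes D)"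
  using assms by (auto elim!: reduces.cases simp: card_gt_0_iff simp del: card_Diff_insert card_Diff_singleton intro: card_Diff1_less)

lemma reduces_normal_form:
  assumes "finite (nodes D)"
  shows "\<exists>D'. reduces\<^sup>*\<^sup>* D D' \<and> (\<nexists>D''. reduces D' D'')"
  using assms
proof (induction "card (nodes D)" arbitrary: D rule: less_induct)
  case less
  show ?case
  proof (cases "\<exists>D'. reduces D D'")
    case True
    then obtain D' where D': "reduces D D'" by blast
    from less.hyps[OF reduces_nodes(2,1)[OF D' less.prems]] D' show ?thesis
      by (meson converse_rtranclp_into_rtranclp)
  qed auto
qed

lemma finite_nodes_decision_tree: "finite (nodes (decision_tree es \<S>))"
proof -
  have "{p :: bool list. length p < length es} \<subseteq> {p. set p \<subseteq> UNIV \<and> length p \<le> length es}"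
    by auto
  then show ?thesis
    using finite_lists_length_le[of "UNIV :: bool set" "length es"]
    by (auto simp: decision_tree_def intro: finite_subset)
qed

lemma is_ZDD_ZDD: "is_ZDD es \<S> (ZDD es \<S>)"
  unfolding ZDD_def
  by (rule someI_ex) (use reduces_normal_form[OF finite_nodes_decision_tree] in \<open>simp add: is_ZDD_def\<close>)

end

theory Submission
  imports Defs
begin

text \<open>Take \<open>m\<close> parallel pairs \<open>x\<^sub>j, y\<^sub>j\<close> and truncate to rank 2. This matroid is laminar, and its
  connectivity at \<open>X = {x\<^sub>1, \<dots>, x\<^sub>m}\<close> is \<open>2 + 2 - 2 = 2\<close>. With \<open>X\<close> first in the order, choosing just
  \<open>x\<^sub>j\<close> forbids \<open>y\<^sub>j\<close> but no other single \<open>y\<^sub>k\<close>, so the \<open>m - 1\<close> choices with \<open>j \<noteq> 1\<close> have pairwise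
  different cofactors on the remaining elements, each with a member that contains \<open>y\<^sub>1\<close>. A reduced
  diagram must have a separate node labeled \<open>y\<^sub>1\<close> for each of them.\<close>

section \<open>Cofactors and the width of a ZDD\<close>

text \<open>The set-family version of a subfunction of a Boolean function: what remains to be
  decided from position \<open>i\<close> on, once \<open>X\<close> has been chosen before
  it.\<close>

definition cofactor :: "'a list \<Rightarrow> 'a set set \<Rightarrow> nat \<Rightarrow> 'a set \<Rightarrow> 'a set set" where
  "cofactor es \<S> i X = {Y. Y \<subseteq> set (drop i es) \<and> X \<union> Y \<in> \<S>}"

definition path_set :: "'a list \<Rightarrow> bool list \<Rightarrow> 'a set" where
  "path_set es p = {es ! j | j. j < length p \<and> p ! j}"

abbreviation path_cofactor :: "'a list \<Rightarrow> 'a set set \<Rightarrow> bool list \<Rightarrow> 'a set set" where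
  "path_cofactor es \<S> p \<equiv> cofactor es \<S> (length p) (path_set es p)"

lemma path_set_append:
  "path_set es (p @ [b]) = path_set es p \<union> (if b then {es ! length p} else {})"
proof -
  have "{j. j < length (p @ [b]) \<and> (p @ [b]) ! j} =
      {j. j < length p \<and> p ! j} \<union> (if b then {length p} else {})"
    by (auto simp: nth_append split: if_splits)
  then show ?thesis
    unfolding path_set_def setcompr_eq_image by (simp add: image_Un)
qed

lemma path_set_append_False [simp]: "path_set es (p @ [False]) = path_set es p"
  by (simp add: path_set_append)

lemma path_set_append_True [simp]:
  "path_set es (p @ [True]) = insert (es ! length p) (path_set es p)"
  by (simp add: path_set_append)

lemma set_drop_conv_insert:
  "i < length es \<Longrightarrow> set (drop i es) = insert (es ! i) (set (drop (Suc i) es))"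
  by (metis Cons_nth_drop_Suc list.simps(15))

text \<open>Split the members by whether they contain \<open>es ! i\<close>. The cofactors at the
  two children of a node thus determine the cofactor at the node, which is what both reduction rules
  rely on.\<close>

lemma cofactor_step:
  assumes "i < length es"
  shows "cofactor es \<S> i X =
    cofactor es \<S> (Suc i) X \<union> insert (es ! i) ` cofactor es \<S> (Suc i) (insert (es ! i) X)"
    (is "?L = ?A \<union> ?B")
proof (intro equalityI subsetI)
  fix Y assume Y: "Y \<in> ?L"
  show "Y \<in> ?A \<union> ?B"
  proof (cases "es ! i \<in> Y")
    case True
    then have "Y = insert (es ! i) (Y - {es ! i})"
      by auto
    moreover have "Y - {es ! i} \<in> cofactor es \<S> (Suc i) (insert (es ! i) X)"
    proof -
      have "insert (es ! i) X \<union> (Y - {es ! i}) = X \<union> Y"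
        using True by auto
      then show ?thesis
        using Y assms by (auto simp: cofactor_def set_drop_conv_insert)
    qed
    ultimately show ?thesis by blast
  next
    case False
    then show ?thesis
      using Y assms by (auto simp: cofactor_def set_drop_conv_insert)
  qed
next
  fix Y assume "Y \<in> ?A \<union> ?B"
  then show "Y \<in> ?L"
    using assms by (auto simp: cofactor_def set_drop_conv_insert)
qed

section \<open>Invariant of the reduction\<close>

text \<open>The map \<open>\<pi>\<close> records which vertex of the partially reduced diagram each vertex of the decision
  tree has been redirected to.\<close>

definition represents ::
    "'a list \<Rightarrow> 'a set set \<Rightarrow> (bool list, 'a) diagram \<Rightarrow> (bool list \<Rightarrow> bool list vertex) \<Rightarrow> bool" where
  "represents es \<S> D \<pi> \<longleftrightarrow>
     label D = (\<lambda>p. es ! length p) \<and>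
     nodes D \<subseteq> {p. length p < length es} \<and>
     (\<forall>u \<in> nodes D. lo D u = \<pi> (u @ [False]) \<and> hi D u = \<pi> (u @ [True])) \<and>
     (\<forall>p. length p \<le> length es \<longrightarrow>
       (case \<pi> p of
          Bot \<Rightarrow> path_cofactor es \<S> p = {}
        | Top \<Rightarrow> path_cofactor es \<S> p = {{}}
        | Inner u \<Rightarrow> u \<in> nodes D \<and> length p \<le> length u \<and>
            path_cofactor es \<S> p = path_cofactor es \<S> u))"

lemma representsD:
  assumes "represents es \<S> D \<pi>"
  shows "label D = (\<lambda>p. es ! length p)"
    and "u \<in> nodes D \<Longrightarrow> length u < length es"
    and "u \<in> nodes D \<Longrightarrow> lo D u = \<pi> (u @ [False])"
    and "u \<in> nodes D \<Longrightarrow> hi D u = \<pi> (u @ [True])"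
    and "length p \<le> length es \<Longrightarrow> \<pi> p = Bot \<Longrightarrow> path_cofactor es \<S> p = {}"
    and "length p \<le> length es \<Longrightarrow> \<pi> p = Top \<Longrightarrow> path_cofactor es \<S> p = {{}}"
    and "length p \<le> length es \<Longrightarrow> \<pi> p = Inner u \<Longrightarrow>
      u \<in> nodes D \<and> length p \<le> length u \<and> path_cofactor es \<S> p = path_cofactor es \<S> u"
proof -
  have case_p: "case \<pi> p of
          Bot \<Rightarrow> path_cofactor es \<S> p = {}
        | Top \<Rightarrow> path_cofactor es \<S> p = {{}}
        | Inner u \<Rightarrow> u \<in> nodes D \<and> length p \<le> length u \<and>
            path_cofactor es \<S> p = path_cofactor es \<S> u" if "length p \<le> length es" for p
    using assms that unfolding represents_def by blast
  show "length p \<le> length es \<Longrightarrow> \<pi> p = Bot \<Longrightarrow> path_cofactor es \<S> p = {}"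
    "length p \<le> length es \<Longrightarrow> \<pi> p = Top \<Longrightarrow> path_cofactor es \<S> p = {{}}"
    "length p \<le> length es \<Longrightarrow> \<pi> p = Inner u \<Longrightarrow>
      u \<in> nodes D \<and> length p \<le> length u \<and> path_cofactor es \<S> p = path_cofactor es \<S> u"
    using case_p[of p] by simp_all
qed (use assms in \<open>unfold represents_def, blast\<close>)+

text \<open>A vertex of the diagram stands for a single family, so \<open>\<pi> p\<close> alone
  determines the cofactor of \<open>p\<close>. Merging only compares successors; this turns their
  equality into equality of cofactors.\<close>

lemma represents_cofactor_eq:
  assumes "represents es \<S> D \<pi>" "length p \<le> length es" "length q \<le> length es" "\<pi> p = \<pi> q"
  shows "path_cofactor es \<S> p = path_cofactor es \<S> q"
proof (cases "\<pi> q")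
  case Bot
  then show ?thesis
    using assms(4) representsD(5)[OF assms(1,2)] representsD(5)[OF assms(1,3)] by simp
next
  case Top
  then show ?thesis
    using assms(4) representsD(6)[OF assms(1,2)] representsD(6)[OF assms(1,3)] by simp
next
  case (Inner u)
  then show ?thesis
    using assms(4) representsD(7)[OF assms(1,2), of u] representsD(7)[OF assms(1,3), of u] by simp
qed

lemma represents_decision_tree:
  "represents es \<S> (decision_tree es \<S>) (tree_vertex es \<S>)"
proof -
  \<comment> \<open>At a leaf no elements remain, so \<open>{}\<close> is the only possible
    member.\<close>
  have "path_cofactor es \<S> p = (if path_set es p \<in> \<S> then {{}} else {})"
    if "length p = length es" for p
    using that by (auto simp: cofactor_def)
  then show ?thesis
    by (simp add: represents_def decision_tree_def tree_vertex_def path_set_def)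
      (auto simp: cofactor_def)
qed

text \<open>Common core of both reduction rules: the target \<open>w\<close> must stand for the same
  family as \<open>v\<close>. An inner target must also survive the deletion of \<open>v\<close> and
  lie at least as deep, so that depths never decrease along \<open>\<pi>\<close>.\<close>

lemma represents_redirect:
  assumes rep: "represents es \<S> D \<pi>"
    and w: "case w of
        Bot \<Rightarrow> path_cofactor es \<S> v = {}
      | Top \<Rightarrow> path_cofactor es \<S> v = {{}}
      | Inner u \<Rightarrow> u \<in> nodes D \<and> u \<noteq> v \<and> length v \<le> length u \<and>
          path_cofactor es \<S> v = path_cofactor es \<S> u"
  shows "represents es \<S> (redirect D v w) ((\<lambda>x. if x = Inner v then w else x) \<circ> \<pi>)"
  unfolding represents_def
proof (intro conjI allI impI)
  fix p :: "bool list" assume p: "length p \<le> length es"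
  note P = representsD(5-7)[OF rep p]
  show "case ((\<lambda>x. if x = Inner v then w else x) \<circ> \<pi>) p of
          Bot \<Rightarrow> path_cofactor es \<S> p = {}
        | Top \<Rightarrow> path_cofactor es \<S> p = {{}}
        | Inner u \<Rightarrow> u \<in> nodes (redirect D v w) \<and> length p \<le> length u \<and>
            path_cofactor es \<S> p = path_cofactor es \<S> u"
  proof (cases "\<pi> p = Inner v")
    case True
    then show ?thesis
      using P(3)[OF True] w by (cases w) auto
  next
    case False
    then show ?thesis
      using P by (cases "\<pi> p") auto
  qed
qed (use representsD(1-4)[OF rep] in \<open>auto simp: redirect_def Let_def\<close>)

lemma represents_reduces:
  assumes red: "reduces D D'" and rep: "represents es \<S> D \<pi>" and dist: "distinct es"
  shows "\<exists>\<pi>'. represents es \<S> D' \<pi>'"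
  using red
proof cases
  case (merge u v)
  have len: "length u < length es" "length v < length es"
    using representsD(2)[OF rep] merge by auto
  \<comment> \<open>Labels of distinct elements determine the depth, so only nodes of one level get
    merged.\<close>
  then have eq: "length u = length v"
    using merge representsD(1)[OF rep] dist by (simp add: nth_eq_iff_index_eq)
  have "path_cofactor es \<S> (u @ [b]) = path_cofactor es \<S> (v @ [b])" for b
    using merge representsD(3,4)[OF rep] len
    by (intro represents_cofactor_eq[OF rep]) (cases b; auto)+
  from this[of False] this[of True]
  have "path_cofactor es \<S> v = path_cofactor es \<S> u"
    using len by (simp add: cofactor_step eq)
  then show ?thesis
    using represents_redirect[OF rep, where v = v and w = "Inner u"] merge eq by auto
next
  case (remove v)
  have len: "length v < length es"
    using representsD(2)[OF rep] remove by auto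
  have "path_cofactor es \<S> (v @ [True]) = {}"
    using remove representsD(4)[OF rep] len by (intro representsD(5)[OF rep]) auto
  \<comment> \<open>No member contains the label of \<open>v\<close>, so the second part of
    \<open>cofactor_step\<close> vanishes.\<close>
  then have "path_cofactor es \<S> v = path_cofactor es \<S> (v @ [False])"
    using len by (simp add: cofactor_step)
  \<comment> \<open>An inner 0-successor has depth at least \<open>length v + 1\<close> and hence
    differs from \<open>v\<close>.\<close>
  then have "represents es \<S> D' ((\<lambda>x. if x = Inner v then lo D v else x) \<circ> \<pi>)"
    unfolding remove(1)
    using remove representsD(3)[OF rep] representsD(5-7)[OF rep, of "v @ [False]"] len
    by (intro represents_redirect[OF rep]) (auto split: vertex.split)
  then show ?thesis by blast
qed

lemma represents_ZDD:
  assumes "distinct es"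
  shows "\<exists>\<pi>. represents es \<S> (ZDD es \<S>) \<pi>"
proof -
  have "reduces\<^sup>*\<^sup>* (decision_tree es \<S>) (ZDD es \<S>)"
    using is_ZDD_ZDD[of es \<S>] by (simp add: is_ZDD_def)
  then show ?thesis
    by induction (use represents_decision_tree represents_reduces assms in blast)+
qed

section \<open>Lower bound for the width\<close>

text \<open>Every counted cofactor is the cofactor of some node labeled \<open>es ! i\<close>: a
  member containing \<open>es ! i\<close> rules out the terminals and every node below level
  \<open>i\<close>.\<close>

lemma card_cofactors_le_width:
  assumes dist: "distinct es" and i: "i < length es"
  shows "card (cofactor es \<S> i `
      {X. X \<subseteq> set (take i es) \<and> (\<exists>Y \<in> cofactor es \<S> i X. es ! i \<in> Y)}) \<le> width es (ZDD es \<S>) i"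
    (is "card (_ ` ?Xs) \<le> _")
proof -
  let ?D = "ZDD es \<S>"
  let ?N = "{v \<in> nodes ?D. label ?D v = es ! i}"
  obtain \<pi> where rep: "represents es \<S> ?D \<pi>"
    using represents_ZDD[OF dist] by blast
  have "nodes ?D \<subseteq> {p. set p \<subseteq> UNIV \<and> length p \<le> length es}"
    using representsD(2)[OF rep] by (auto intro: less_imp_le)
  then have fin: "finite ?N"
    using finite_lists_length_le[of "UNIV :: bool set" "length es"] by (auto intro: finite_subset)
  have "cofactor es \<S> i ` ?Xs \<subseteq> path_cofactor es \<S> ` ?N"
  proof
    fix C assume "C \<in> cofactor es \<S> i ` ?Xs"
    then obtain X Y where X: "X \<subseteq> set (take i es)" "C = cofactor es \<S> i X"
      and Y: "Y \<in> C" "es ! i \<in> Y" by auto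
    \<comment> \<open>The path of length \<open>i\<close> that takes 1-arcs exactly at the elements
      of \<open>X\<close>.\<close>
    define p where "p = map (\<lambda>j. es ! j \<in> X) [0..<i]"
    have p: "length p = i" by (simp add: p_def)
    have "path_set es p = X"
    proof
      show "X \<subseteq> path_set es p"
      proof
        fix x assume x: "x \<in> X"
        with X(1) i obtain j where "j < i" "x = es ! j"
          by (auto simp: in_set_conv_nth dest!: subsetD)
        with x show "x \<in> path_set es p"
          by (auto simp: path_set_def p_def)
      qed
    qed (auto simp: path_set_def p_def)
    then have C: "C = path_cofactor es \<S> p"
      by (simp add: X p)
    have "C \<noteq> {}" "C \<noteq> {{}}" using Y by auto
    then obtain u where u: "u \<in> nodes ?D" "i \<le> length u" "C = path_cofactor es \<S> u"
      using representsD(5-7)[OF rep, of p] p i C by (cases "\<pi> p") auto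
    \<comment> \<open>If \<open>u\<close> were deeper than \<open>i\<close>, distinctness would keep
      \<open>es ! i\<close> out of all members of its cofactor.\<close>
    have "es ! i \<in> set (drop (length u) es)"
      using Y u(3) by (auto simp: cofactor_def)
    then obtain k where "k < length es - length u" "es ! (length u + k) = es ! i"
      by (auto simp: in_set_conv_nth)
    then have "length u + k = i"
      using i dist by (simp add: nth_eq_iff_index_eq)
    with u(2) have "length u = i" by simp
    then show "C \<in> path_cofactor es \<S> ` ?N"
      using u representsD(1)[OF rep] by auto
  qed
  then have "card (cofactor es \<S> i ` ?Xs) \<le> card (path_cofactor es \<S> ` ?N)"
    using fin by (intro card_mono) auto
  also have "\<dots> \<le> card ?N"
    using fin by (rule card_image_le)
  finally show ?thesis by (simp add: width_def)
qed

section \<open>Truncated partition matroids\<close>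

text \<open>The blocks of the partition are the fibers of \<open>g\<close>, each with capacity one;
  the bound on the cardinality is the truncation to rank at most \<open>k\<close>.\<close>

definition truncated_partition :: "'a set \<Rightarrow> ('a \<Rightarrow> 'b) \<Rightarrow> nat \<Rightarrow> 'a set set" where
  "truncated_partition E g k = {S. S \<subseteq> E \<and> inj_on g S \<and> card S \<le> k}"

lemma matroid_truncated_partition:
  assumes "finite E"
  shows "matroid E (truncated_partition E g k)"
proof -
  let ?I = "truncated_partition E g k"
  have fin: "finite S" if "S \<in> ?I" for S
    using that assms by (auto simp: truncated_partition_def intro: finite_subset)
  have "\<exists>y\<in>Y - X. insert y X \<in> ?I" if X: "X \<in> ?I" and Y: "Y \<in> ?I" and lt: "card X < card Y" for X Y
  proof -
    \<comment> \<open>For exchange, \<open>Y\<close> meets more fibers than \<open>X\<close>; an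
      element of \<open>Y\<close> in a fiber missed by \<open>X\<close> can be added.\<close>
    have "card (g ` X) < card (g ` Y)"
      using X Y lt by (simp add: truncated_partition_def card_image)
    then have "\<not> g ` Y \<subseteq> g ` X"
      using fin[OF X] card_mono[of "g ` X" "g ` Y"] by auto
    then obtain y where y: "y \<in> Y" "g y \<notin> g ` X" by auto
    then have "insert y X \<in> ?I"
      using X Y lt fin[OF X] by (auto simp: truncated_partition_def card_insert_if)
    with y show ?thesis by auto
  qed
  moreover have "X \<in> ?I" if "X \<subseteq> Y" "Y \<in> ?I" for X Y
    using that fin[OF that(2)] card_mono[of Y X]
    by (auto simp: truncated_partition_def intro: inj_on_subset)
  moreover have "{} \<in> ?I" "?I \<subseteq> Pow E"
    by (auto simp: truncated_partition_def)
  ultimately show ?thesis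
    using assms unfolding matroid_def by blast
qed

lemma inj_on_iff_card_fibers:
  assumes "finite S"
  shows "inj_on g S \<longleftrightarrow> (\<forall>v. card {x \<in> S. g x = v} \<le> 1)"
proof -
  have "card {x \<in> S. g x = v} \<le> 1 \<longleftrightarrow> (\<forall>x\<in>S. \<forall>y\<in>S. g x = v \<longrightarrow> g y = v \<longrightarrow> x = y)" for v
    using assms by (auto simp: card_le_Suc0_iff_eq)
  then show ?thesis
    by (auto simp: inj_on_def)
qed

text \<open>Disjoint fibers of capacity 1 together with the ground set of capacity \<open>k\<close>
  form a laminar family. By \<open>proper\<close> the ground set is not itself a fiber, so these
  capacities do not conflict.\<close>

lemma laminar_truncated_partition:
  assumes fin: "finite E" and proper: "\<And>v. {x \<in> E. g x = v} \<noteq> E"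
  shows "laminar_matroid E (truncated_partition E g k)"
proof -
  define \<A> where "\<A> = insert E (range (\<lambda>v. {x \<in> E. g x = v}))"
  define c where "c = (\<lambda>A. if A = E then k else 1)"
  have "laminar_family E \<A>"
    by (auto simp: laminar_family_def \<A>_def)
  moreover have "I \<in> truncated_partition E g k \<longleftrightarrow> (\<forall>A\<in>\<A>. card (I \<inter> A) \<le> c A)" if "I \<subseteq> E" for I
  proof -
    have "I \<inter> E = I" "\<And>v. I \<inter> {x \<in> E. g x = v} = {x \<in> I. g x = v}"
      using that by auto
    then show ?thesis
      using that proper inj_on_iff_card_fibers[OF finite_subset[OF that fin], of g]
      by (auto simp: \<A>_def c_def truncated_partition_def)
  qed
  ultimately show ?thesis
    using matroid_truncated_partition[OF fin] unfolding laminar_matroid_def by blast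
qed

lemma rank_truncated_partition:
  assumes "finite E" "B \<subseteq> X" "B \<in> truncated_partition E g k" "card B = k"
  shows "rank_of (truncated_partition E g k) X = k"
proof -
  have "finite (truncated_partition E g k)"
    using assms(1) by (auto simp: truncated_partition_def intro: finite_subset[of _ "Pow E"])
  then show ?thesis
    unfolding rank_of_def using assms
    by (intro Max_eqI) (auto simp: truncated_partition_def intro!: image_eqI[of _ _ B])
qed

section \<open>Parallel pairs truncated to rank two\<close>

text \<open>For \<open>1 \<le> j \<le> m\<close>, the numbers \<open>j - 1\<close> and \<open>j - 1 + m\<close> stand for \<open>x\<^sub>j\<close> and \<open>y\<^sub>j\<close>.\<close>

abbreviation parallel_pairs :: "nat \<Rightarrow> nat set set" where
  "parallel_pairs m \<equiv> truncated_partition {0..<2 * m} (\<lambda>x. x mod m) 2"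

lemma laminar_parallel_pairs:
  assumes "2 \<le> m"
  shows "laminar_matroid {0..<2 * m} (parallel_pairs m)"
proof (rule laminar_truncated_partition)
  fix v
  have "0 \<in> {0..<2 * m}" "1 \<in> {0..<2 * m}" "0 mod m \<noteq> 1 mod m"
    using assms by auto
  then show "{x \<in> {0..<2 * m}. x mod m = v} \<noteq> {0..<2 * m}"
    by (metis (mono_tags, lifting) mem_Collect_eq)
qed simp

text \<open>The side \<open>{0..<m}\<close>, its complement and the ground set each contain one of
  the bases \<open>{0, 1}\<close> and \<open>{m, m + 1}\<close>, so all three ranks are 2, whatever
  the size of \<open>m\<close>.\<close>

lemma connectivity_parallel_pairs:
  assumes "2 \<le> m"
  shows "connectivity {0..<2 * m} (parallel_pairs m) {0..<m} = 2"
proof -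
  have B: "{0, 1} \<in> parallel_pairs m" "{m, m + 1} \<in> parallel_pairs m"
    using assms by (auto simp: truncated_partition_def mod_Suc)
  have "rank_of (parallel_pairs m) X = 2" if "{0, 1} \<subseteq> X \<or> {m, m + 1} \<subseteq> X" for X
    using that
  proof
    assume "{0, 1} \<subseteq> X"
    then show ?thesis
      using B(1) by (rule rank_truncated_partition[rotated]) auto
  next
    assume "{m, m + 1} \<subseteq> X"
    then show ?thesis
      using B(2) by (rule rank_truncated_partition[rotated]) auto
  qed
  moreover have "{0, 1} \<subseteq> {0..<m}" "{0, 1} \<subseteq> {0..<2 * m}" "{m, m + 1} \<subseteq> {0..<2 * m} - {0..<m}"
    using assms by auto
  ultimately show ?thesis
    by (simp add: connectivity_def)
qed

lemma width_parallel_pairs: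
  assumes m: "2 \<le> m"
  shows "m - 1 \<le> width [0..<2 * m] (ZDD [0..<2 * m] (parallel_pairs m)) m"
proof -
  let ?es = "[0..<2 * m]"
  let ?C = "cofactor ?es (parallel_pairs m) m"
  let ?Xs = "{X. X \<subseteq> set (take m ?es) \<and> (\<exists>Y \<in> ?C X. ?es ! m \<in> Y)}"
  \<comment> \<open>Since \<open>(k + m) mod m = k\<close>, the element \<open>k + m\<close> is
    parallel to \<open>j\<close> exactly when \<open>j = k\<close>. So \<open>{k + m}\<close>
    separates the cofactor of \<open>{k}\<close> from the others.\<close>
  have mem: "{k + m} \<in> ?C {j} \<longleftrightarrow> j \<noteq> k" if "j < m" "k < m" for j k
    using that by (auto simp: cofactor_def truncated_partition_def)
  have "inj_on (\<lambda>j. ?C {j}) {1..<m}"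
  proof (rule inj_onI, rule ccontr)
    fix j k assume "j \<in> {1..<m}" "k \<in> {1..<m}" "?C {j} = ?C {k}" "j \<noteq> k"
    then show False using mem[of j k] mem[of k k] by auto
  qed
  then have "m - 1 = card ((\<lambda>j. ?C {j}) ` {1..<m})"
    by (simp add: card_image)
  also have "\<dots> \<le> card (?C ` ?Xs)"
  proof (rule card_mono)
    show "finite (?C ` ?Xs)" by simp
    \<comment> \<open>The index 0 is left out because 0 is parallel to \<open>m\<close>, the label
      of the level considered.\<close>
    have "{j} \<in> ?Xs" if "j \<in> {1..<m}" for j
    proof -
      have "{m} \<in> ?C {j}" using mem[of j 0] that by auto
      then show ?thesis using that m by auto
    qed
    then show "(\<lambda>j. ?C {j}) ` {1..<m} \<subseteq> ?C ` ?Xs"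
      by (intro image_subsetI imageI)
  qed
  also have "\<dots> \<le> width ?es (ZDD ?es (parallel_pairs m)) m"
    using m by (intro card_cofactors_le_width) auto
  finally show ?thesis .
qed

theorem theorem4p10:
  "\<not> (\<exists>f :: nat \<Rightarrow> nat. \<forall>(E :: nat set) (\<I> :: nat set set) (R :: nat rel) (es :: nat list).
        laminar_matroid E \<I> \<and> linear_order_on E R \<and>
        set es = E \<and> sorted_wrt (\<lambda>x y. (x, y) \<in> R \<and> x \<noteq> y) es \<longrightarrow>
        (\<forall>i < length es. width es (ZDD es \<I>) i \<le> f (connectivity E \<I> (set (take i es)))))"
proof
  assume "\<exists>f :: nat \<Rightarrow> nat. \<forall>(E :: nat set) (\<I> :: nat set set) (R :: nat rel) (es :: nat list).
        laminar_matroid E \<I> \<and> linear_order_on E R \<and>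
        set es = E \<and> sorted_wrt (\<lambda>x y. (x, y) \<in> R \<and> x \<noteq> y) es \<longrightarrow>
        (\<forall>i < length es. width es (ZDD es \<I>) i \<le> f (connectivity E \<I> (set (take i es))))"
  then obtain f :: "nat \<Rightarrow> nat" where f: "\<forall>(E :: nat set) (\<I> :: nat set set) (R :: nat rel) (es :: nat list).
        laminar_matroid E \<I> \<and> linear_order_on E R \<and>
        set es = E \<and> sorted_wrt (\<lambda>x y. (x, y) \<in> R \<and> x \<noteq> y) es \<longrightarrow>
        (\<forall>i < length es. width es (ZDD es \<I>) i \<le> f (connectivity E \<I> (set (take i es))))"
    by (rule exE)
  \<comment> \<open>The connectivity will be 2 and the width at least \<open>m - 1\<close>, which
    this choice makes \<open>f 2 + 1\<close>.\<close>
  define m where "m = f 2 + 2"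
  have m: "2 \<le> m" by (simp add: m_def)
  \<comment> \<open>The usual order, restricted so that it is a relation on the ground set.\<close>
  define R where "R = {(x, y). x \<le> y \<and> x < 2 * m \<and> y < 2 * m}"
  have "linear_order_on {0..<2 * m} R"
    by (auto simp: R_def linear_order_on_def partial_order_on_def preorder_on_def refl_on_def
        trans_def antisym_def total_on_def)
  moreover have "sorted_wrt (\<lambda>x y. (x, y) \<in> R \<and> x \<noteq> y) [0..<2 * m]"
    by (auto simp: R_def sorted_wrt_iff_nth_less)
  ultimately have "width [0..<2 * m] (ZDD [0..<2 * m] (parallel_pairs m)) m \<le>
      f (connectivity {0..<2 * m} (parallel_pairs m) (set (take m [0..<2 * m])))"
    using m laminar_parallel_pairs[OF m] by (intro f[rule_format]) auto
  moreover have "set (take m [0..<2 * m]) = {0..<m}"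
    using m by simp
  ultimately have "m - 1 \<le> f 2"
    using width_parallel_pairs[OF m] connectivity_parallel_pairs[OF m] by simp
  then show False by (simp add: m_def)
qed

end
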